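(* Let $n\ge1$. The mapping $\vartheta:\mathcal B_n\to\mathcal B_n$ is an involution that preserves the right chain sequences and switches the statistics $\mathsf{spi}$ and $\mathsf{rspi}$; that is, for all $B\in\mathcal B_n$, $\vartheta(\vartheta(B))=B$, the right chain sequences of $B$ and $\vartheta(B)$ coincide, $\mathsf{spi}(\vartheta(B))=\mathsf{rspi}(B)$ and $\mathsf{rspi}(\vartheta(B))=\mathsf{spi}(B)$.
   Context: A binary tree is a rooted tree in which each node has at most one left child and at most one right child; $\mathcal B_n$ is the set of binary trees with $n$ nodes. **Orders.** The preorder visits, recursively, the parent, then its left subtree, then its right subtree. The reverse preorder visits, recursively, the right subtree, then the left subtree, then the parent (so it is the reversal of the preorder). **Statistics.** $\mathsf{spi}(B)$ is the smallest $i$ such that the $(i+1)$-th node of $B$ under the preorder is a right child. $\mathsf{rspi}(B)$ is the smallest $i$ such that the $(i+1)$-th node of $B$ under the reverse preorder has a right child. By convention, if $B$ is the binary tree with $n$ nodes having only left edges, $\mathsf{spi}(B)=\mathsf{rspi}(B)=n$. **Right chains.** A right chain of $B$ is a maximal path composed only of right edges (single nodes with no incident right edge count as right chains of length $0$); its length is its number of right edges. The right chain sequence of $B$ is the multiset of the lengths of all right chains of $B$. **The map $\vartheta$.** Let $B\in\mathcal B_n$ and let $v_i$ be the $i$-th node of $B$ under the preorder. Then $\vartheta(B)$ is the binary tree on the nodes $v_1,\dots,v_n$ with root $v_n$ such that, for $i$ from $n-1$ down to $1$: if $v_i$ has right child $v_\ell$ ($\ell>i$) in $B$, then $v_i$ is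 the right child of $v_\ell$ in $\vartheta(B)$; otherwise ($v_i$ has no right child in $B$), $v_i$ is the left child of $v_{i+1}$ in $\vartheta(B)$. Trees in $\mathcal B_n$ are considered as unlabeled; the names $v_i$ only serve the construction. *)

theory Defs
  imports Main "HOL-Library.Tree" "HOL-Library.Sublist" "HOL-Library.Multiset" "HOL-Library.FuncSet"
begin

text \<open>
  Unlabeled binary trees are values of type \<^typ>\<open>unit tree\<close>, the size being the number of
  (internal) nodes; \<^term>\<open>Leaf\<close> stands for an absent child.
\<close>

definition binary_trees :: "nat \<Rightarrow> unit tree set" where
  "binary_trees n = {B. size B = n}"

text \<open>
  To speak about individual nodes, an unlabeled tree is decorated with the positions of its nodes
  in preorder, starting at 1: the label \<open>i\<close> is the node \<open>v\<^sub>i\<close>.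
\<close>

fun number_from :: "nat \<Rightarrow> 'a tree \<Rightarrow> nat tree" where
  "number_from i Leaf = Leaf"
| "number_from i (Node l _ r) = Node (number_from (i + 1) l) i (number_from (i + 1 + size l) r)"

definition numbered :: "'a tree \<Rightarrow> nat tree" where
  "numbered B = number_from 1 B"

definition unlabel :: "'a tree \<Rightarrow> unit tree" where
  "unlabel T = map_tree (\<lambda>_. ()) T"

lemma preorder_number_from: "preorder (number_from i B) = [i..<i + size B]"
proof (induction B arbitrary: i)
  case (Node l a r)
  have "[i..<i + size (Node l a r)] = i # [i + 1..<i + 1 + size l + size r]"
    by (subst upt_conv_Cons) (simp_all add: add.assoc)
  also have "\<dots> = i # [i + 1..<i + 1 + size l] @ [i + 1 + size l..<i + 1 + size l + size r]"
    by (subst upt_add_eq_append) simp_all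
  finally show ?case
    using Node by simp
qed simp

lemma preorder_numbered: "preorder (numbered B) = [1..<size B + 1]"
  unfolding numbered_def preorder_number_from by simp

fun right_edges :: "'a tree \<Rightarrow> ('a \<times> 'a) set" where
  "right_edges Leaf = {}"
| "right_edges (Node l a r) =
     (case r of Leaf \<Rightarrow> {} | Node _ b _ \<Rightarrow> {(a, b)}) \<union> right_edges l \<union> right_edges r"

fun rev_preorder :: "'a tree \<Rightarrow> 'a list" where
  "rev_preorder Leaf = []"
| "rev_preorder (Node l a r) = rev_preorder r @ rev_preorder l @ [a]"

lemma rev_preorder_eq: "rev_preorder T = rev (preorder T)"
  by (induction T) auto

text \<open>
  List positions are counted from 0, so \<open>xs ! i\<close> is the \<open>(i + 1)\<close>-th node of the order \<open>xs\<close>.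
\<close>

definition spi :: "unit tree \<Rightarrow> nat" where
  "spi B = (let T = numbered B in
     if right_edges T = {} then size B
     else (LEAST i. i < size B \<and> (\<exists>u. (u, preorder T ! i) \<in> right_edges T)))"

definition rspi :: "unit tree \<Rightarrow> nat" where
  "rspi B = (let T = numbered B in
     if right_edges T = {} then size B
     else (LEAST i. i < size B \<and> (\<exists>w. (rev_preorder T ! i, w) \<in> right_edges T)))"

definition right_path :: "'a tree \<Rightarrow> 'a list \<Rightarrow> bool" where
  "right_path T p \<longleftrightarrow>
     p \<noteq> [] \<and> set p \<subseteq> set_tree T \<and> successively (\<lambda>u w. (u, w) \<in> right_edges T) p"

definition right_chain :: "'a tree \<Rightarrow> 'a list \<Rightarrow> bool" where
  "right_chain T p \<longleftrightarrow> right_path T p \<and> (\<forall>q. right_path T q \<and> sublist p q \<longrightarrow> q = p)"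

text \<open>The number of edges of a path is one less than its number of nodes.\<close>

definition right_chain_sequence :: "unit tree \<Rightarrow> nat multiset" where
  "right_chain_sequence B =
     image_mset (\<lambda>p. length p - 1) (mset_set {p. right_chain (numbered B) p})"

text \<open>
  \<^const>\<open>mset_set\<close> of an infinite set would be empty, so we check that the set above is finite.
\<close>

lemma set_number_from: "set_tree (number_from i B) = {i..<i + size B}"
  by (metis preorder_number_from set_preorder set_upt)

lemma right_edges_number_from_less: "(u, w) \<in> right_edges (number_from i B) \<Longrightarrow> u < w"
proof (induction B arbitrary: i)
  case (Node l a r)
  have "(case number_from (i + 1 + size l) r of Leaf \<Rightarrow> {} | Node _ b _ \<Rightarrow> {(i, b)})
      \<subseteq> {(i, i + 1 + size l)}"
    by (cases r) auto
  with Node show ?case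
    by fastforce
qed simp

lemma finite_right_chains: "finite {p. right_chain (numbered B) p}"
proof (rule finite_subset)
  show "{p. right_chain (numbered B) p} \<subseteq> {p. set p \<subseteq> set_tree (numbered B) \<and> distinct p}"
  proof clarify
    fix p assume "right_chain (numbered B) p"
    then have p: "right_path (numbered B) p"
      by (simp add: right_chain_def)
    then have "successively (<) p"
      unfolding right_path_def
      by (auto elim!: successively_mono simp: numbered_def right_edges_number_from_less)
    then have "sorted_wrt (<) p"
      by (simp add: successively_conv_sorted_wrt)
    then show "set p \<subseteq> set_tree (numbered B) \<and> distinct p"
      using p by (auto simp: right_path_def strict_sorted_iff)
  qed
  show "finite {p. set p \<subseteq> set_tree (numbered B) \<and> distinct p}"
    by (rule finite_subset_distinct) simp
qed

text \<open>
  \<open>attach_left p c T\<close> and \<open>attach_right p c T\<close> make a new childless node \<open>c\<close> the left, resp.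
  right, child of the node \<open>p\<close> of \<open>T\<close>. They are only used when \<open>p\<close> has no such child yet.
\<close>

fun attach_left :: "'a \<Rightarrow> 'a \<Rightarrow> 'a tree \<Rightarrow> 'a tree" where
  "attach_left p c Leaf = Leaf"
| "attach_left p c (Node l a r) =
     (if a = p then Node (Node Leaf c Leaf) a r
      else Node (attach_left p c l) a (attach_left p c r))"

fun attach_right :: "'a \<Rightarrow> 'a \<Rightarrow> 'a tree \<Rightarrow> 'a tree" where
  "attach_right p c Leaf = Leaf"
| "attach_right p c (Node l a r) =
     (if a = p then Node l a (Node Leaf c Leaf)
      else Node (attach_right p c l) a (attach_right p c r))"

definition theta_step :: "unit tree \<Rightarrow> nat \<Rightarrow> nat tree \<Rightarrow> nat tree" where
  "theta_step B i T =
     (if \<exists>k. (i, k) \<in> right_edges (numbered B)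
      then attach_right (THE k. (i, k) \<in> right_edges (numbered B)) i T
      else attach_left (i + 1) i T)"

text \<open>
  \<open>fold\<close> runs through \<open>i = n - 1, \<dots>, 1\<close> in this order, where \<open>n = size B\<close>. The construction
  starts from a root \<open>v\<^sub>n\<close> and is meant for \<open>n \<ge> 1\<close> only.
\<close>

definition theta :: "unit tree \<Rightarrow> unit tree" where
  "theta B = unlabel (fold (theta_step B) (rev [1..<size B]) (Node Leaf (size B) Leaf))"

end

theory Submission
  imports Defs
begin

text \<open>
  Read in preorder, \<open>\<vartheta>(B)\<close> visits \<open>v\<^sub>n, \<dots>, v\<^sub>1\<close>: every new node is attached so that it comes last,
  because the right edges of \<open>B\<close> do not cross. Hence \<open>\<vartheta>\<close> acts on the set of right edges, written
  as pairs of preorder positions, by \<open>(u, w) \<mapsto> (n + 1 - w, n + 1 - u)\<close>. This action is an involution,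
  reverses right chains and exchanges \<open>spi\<close> with \<open>rspi\<close>; and a binary tree is determined by its
  size and its right edges.
\<close>

section \<open>Right edges of trees with arbitrary labels\<close>

text \<open>The form with \<open>if\<close> and \<open>value\<close> in place of \<open>case\<close>
  also applies to a right subtree such as \<open>number_from i r\<close>, whose constructor is
  hidden.\<close>

lemma right_edges_Node:
  "right_edges (Node l a r) =
     (if r = Leaf then {} else {(a, value r)}) \<union> right_edges l \<union> right_edges r"
  by (cases r) auto

lemma right_edges_subset: "right_edges T \<subseteq> set_tree T \<times> set_tree T"
proof (induction T)
  case (Node l a r)
  have "value r \<in> set_tree r" if "r \<noteq> Leaf"
    using that by (cases r) auto
  with Node show ?case
    unfolding right_edges_Node by (auto split: if_splits)
qed simp

lemma right_edges_map_tree: "right_edges (map_tree f T) = map_prod f f ` right_edges T"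
proof (induction T)
  case (Node l a r)
  have "value (map_tree f r) = f (value r)" if "r \<noteq> Leaf"
    using that by (cases r) auto
  with Node show ?case
    by (simp add: right_edges_Node image_Un del: right_edges.simps(2))
qed simp

subsection \<open>Right edges in preorder numbering\<close>

lemma size_number_from [simp]: "size (number_from i B) = size B"
  by (induction B arbitrary: i) auto

lemma number_from_eq_Leaf_iff [simp]: "number_from i B = Leaf \<longleftrightarrow> B = Leaf"
  by (cases B) auto

lemma value_number_from [simp]: "B \<noteq> Leaf \<Longrightarrow> value (number_from i B) = i"
  by (cases B) auto

lemma right_edges_number_from_Node:
  "right_edges (number_from i (Node l a r)) =
     (if r = Leaf then {} else {(i, i + 1 + size l)}) \<union>
     right_edges (number_from (i + 1) l) \<union> right_edges (number_from (i + 1 + size l) r)"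
  unfolding number_from.simps right_edges_Node by simp

lemma right_edges_number_from_bounds:
  assumes "(u, w) \<in> right_edges (number_from i B)"
  shows "i \<le> u \<and> u < w \<and> w < i + size B"
  using assms right_edges_subset[of "number_from i B"] right_edges_number_from_less[OF assms]
  by (auto simp: set_number_from)

text \<open>The root, the left subtree and the right subtree carry disjoint label intervals, so both
  edges arise in the same one of the three. This gives the \<open>THE\<close> in
  \<open>theta_step\<close> its meaning.\<close>

lemma right_edges_number_from_unique:
  assumes "(u, w) \<in> right_edges (number_from i B)" "(u, w') \<in> right_edges (number_from i B)"
  shows "w = w'"
  using assms
proof (induction B arbitrary: i)
  case (Node l a r)
  note L = right_edges_number_from_bounds[of _ _ "i + 1" l]
    and R = right_edges_number_from_bounds[of _ _ "i + 1 + size l" r]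
  from Node.prems show ?case
    unfolding right_edges_number_from_Node
    using L[of u w] R[of u w] L[of u w'] R[of u w'] Node.IH
    by (auto split: if_splits)
qed simp

text \<open>The labels strictly between a node and its right child are those of the node's left
  subtree, and edges starting in that subtree stay in it.\<close>

lemma right_edges_number_from_noncrossing:
  assumes "(i, k) \<in> right_edges (number_from j B)" "(u, w) \<in> right_edges (number_from j B)"
    and "i < u" "u < k"
  shows "w < k"
  using assms
proof (induction B arbitrary: j)
  case (Node l a r)
  note L = right_edges_number_from_bounds[of _ _ "j + 1" l]
    and R = right_edges_number_from_bounds[of _ _ "j + 1 + size l" r]
  from Node.prems show ?case
    unfolding right_edges_number_from_Node
    using L[of i k] R[of i k] L[of u w] R[of u w] Node.IH
    by (auto split: if_splits)
qed simp

text \<open>An edge leaving the root ends in \<open>i + 1 + size l\<close>, which reveals the sizes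
  of both subtrees; if there is none, \<open>r\<close> is \<open>Leaf\<close>. The edges of each
  subtree are then recovered from the range of their sources.\<close>

lemma right_edges_number_from_inject:
  fixes B C :: "unit tree"
  assumes "size B = size C" "right_edges (number_from i B) = right_edges (number_from i C)"
  shows "B = C"
  using assms
proof (induction B arbitrary: i C)
  case (Node l a r)
  then obtain l' a' r' where C: "C = Node l' a' r'"
    by (cases C) auto
  have root: "{w. (i, w) \<in> right_edges (number_from i (Node l a r))} =
      (if r = Leaf then {} else {i + 1 + size l})" for l r and a :: unit
    unfolding right_edges_number_from_Node
    by (auto dest: right_edges_number_from_bounds)
  have "(if r = Leaf then {} else {i + 1 + size l}) =
      (if r' = Leaf then {} else {i + 1 + size l'})"
    unfolding root[of l a r, symmetric] root[of l' a' r', symmetric] Node.prems(2) C by (rule refl)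
  then have sizes: "size l = size l'" "size r = size r'"
    using Node.prems(1) C by (auto split: if_splits)
  have left: "right_edges (number_from (i + 1) l) =
      {(u, w) \<in> right_edges (number_from i (Node l a r)). i < u \<and> u < i + 1 + size l}"
    for l r and a :: unit
    unfolding right_edges_number_from_Node
    by (auto split: if_splits dest: right_edges_number_from_bounds)
  have right: "right_edges (number_from (i + 1 + size l) r) =
      {(u, w) \<in> right_edges (number_from i (Node l a r)). i + 1 + size l \<le> u}"
    for l r and a :: unit
    unfolding right_edges_number_from_Node
    by (auto split: if_splits dest: right_edges_number_from_bounds)
  have "right_edges (number_from (i + 1) l) = right_edges (number_from (i + 1) l')"
    unfolding left[of l a r] left[of l' a' r']
    unfolding Node.prems(2) C sizes by (rule refl)
  moreover have "right_edges (number_from (i + 1 + size l) r) =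
      right_edges (number_from (i + 1 + size l') r')"
    unfolding right[of l r a] right[of l' r' a']
    unfolding Node.prems(2) C sizes by (rule refl)
  ultimately show ?case
    using Node.IH sizes C by auto
qed simp

text \<open>Consecutive values along the preorder are the preorder positions, shifted to start at
  \<open>i\<close>. This yields \<open>numbered (theta B)\<close> from the labelled tree that the
  fold builds.\<close>

lemma number_from_unlabel:
  "map f (preorder T) = [i..<i + size T] \<Longrightarrow> number_from i (unlabel T) = map_tree f T"
proof (induction T arbitrary: i)
  case (Node l a r)
  have "[i..<i + size (Node l a r)] =
      i # [i + 1..<i + 1 + size l] @ [i + 1 + size l..<i + 1 + size l + size r]"
    using preorder_number_from[of i "Node l a r"] by (simp add: preorder_number_from)
  with Node.prems have "f a = i"
    and "map f (preorder l) @ map f (preorder r) =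
      [i + 1..<i + 1 + size l] @ [i + 1 + size l..<i + 1 + size l + size r]"
    by simp_all
  moreover from this have "map f (preorder l) = [i + 1..<i + 1 + size l]"
    "map f (preorder r) = [i + 1 + size l..<i + 1 + size l + size r]"
    by (simp_all del: upt_Suc)
  ultimately show ?case
    using Node.IH by (simp add: unlabel_def)
qed (simp add: unlabel_def)

subsection \<open>Attaching a node at the end of the preorder\<close>

lemma attach_left_notin [simp]: "p \<notin> set_tree T \<Longrightarrow> attach_left p c T = T"
  by (induction T) auto

lemma attach_right_notin [simp]: "p \<notin> set_tree T \<Longrightarrow> attach_right p c T = T"
  by (induction T) auto

lemma attach_left_eq_Leaf_iff [simp]: "attach_left p c T = Leaf \<longleftrightarrow> T = Leaf"
  by (cases T) auto

lemma attach_right_eq_Leaf_iff [simp]: "attach_right p c T = Leaf \<longleftrightarrow> T = Leaf"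
  by (cases T) auto

lemma value_attach_left [simp]: "value (attach_left p c T) = value T"
  by (cases T) auto

lemma value_attach_right [simp]: "value (attach_right p c T) = value T"
  by (cases T) auto

text \<open>Labels decrease along the preorder, so the minimum \<open>p\<close> is visited last and
  is childless. A left child added to it comes last and creates no right edge.\<close>

lemma attach_left_last:
  fixes T :: "'a::linorder tree"
  assumes "sorted_wrt (>) (preorder T)" "p \<in> set_tree T" "\<And>x. x \<in> set_tree T \<Longrightarrow> p \<le> x"
  shows "preorder (attach_left p c T) = preorder T @ [c] \<and>
    right_edges (attach_left p c T) = right_edges T"
  using assms
proof (induction T)
  case (Node l a r)
  from Node.prems(1) have sorted: "sorted_wrt (>) (preorder l)" "sorted_wrt (>) (preorder r)"
    and less: "\<And>x. x \<in> set_tree l \<union> set_tree r \<Longrightarrow> x < a"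
    and cross: "\<And>x y. x \<in> set_tree l \<Longrightarrow> y \<in> set_tree r \<Longrightarrow> y < x"
    by (auto simp: sorted_wrt_append)
  show ?case
  proof (cases "a = p")
    case True
    have "set_tree l \<union> set_tree r = {}"
      using less Node.prems(3) True by (fastforce simp: not_less[symmetric])
    then show ?thesis
      using True by simp
  next
    case False
    show ?thesis
    proof (cases "r = Leaf")
      case True
      then show ?thesis
        using Node.IH(1) sorted False Node.prems by auto
    next
      case nonleaf: False
      then obtain y where "y \<in> set_tree r"
        by (cases r) auto
      \<comment> \<open>Labels in \<open>r\<close> are smaller than those in \<open>l\<close>, so
        the minimum is not in \<open>l\<close> and the recursive call on \<open>l\<close> changes
        nothing.\<close>
      then have "p \<notin> set_tree l"
        using cross Node.prems(3) by (fastforce simp: not_less[symmetric])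
      with nonleaf show ?thesis
        using Node.IH(2) sorted False Node.prems
        by (auto simp: right_edges_Node simp del: right_edges.simps(2))
    qed
  qed
qed simp

text \<open>The nodes visited up to \<open>p\<close> are those with label at least \<open>p\<close>.
  By the third assumption no right edge leads from them to a later node: \<open>p\<close> has no
  right child, and no left subtree containing \<open>p\<close> has a right sibling. So the new node
  comes last, after the left subtree of \<open>p\<close>, if any.\<close>

lemma attach_right_last:
  fixes T :: "'a::linorder tree"
  assumes "sorted_wrt (>) (preorder T)" "p \<in> set_tree T"
    and "\<And>u w. (u, w) \<in> right_edges T \<Longrightarrow> p \<le> u \<Longrightarrow> p \<le> w"
  shows "preorder (attach_right p c T) = preorder T @ [c] \<and>
    right_edges (attach_right p c T) = insert (p, c) (right_edges T)"
  using assms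
proof (induction T)
  case (Node l a r)
  from Node.prems(1) have sorted: "sorted_wrt (>) (preorder l)" "sorted_wrt (>) (preorder r)"
    and less: "\<And>x. x \<in> set_tree l \<union> set_tree r \<Longrightarrow> x < a"
    and cross: "\<And>x y. x \<in> set_tree l \<Longrightarrow> y \<in> set_tree r \<Longrightarrow> y < x"
    by (auto simp: sorted_wrt_append)
  have val: "value r \<in> set_tree r" if "r \<noteq> Leaf"
    using that by (cases r) auto
  \<comment> \<open>The root is at least \<open>p\<close>, so the third assumption applies to the
    edge from the root to its right child.\<close>
  have le_val: "p \<le> value r" if "r \<noteq> Leaf"
    using that Node.prems(2,3) less
    by (auto simp: right_edges_Node simp del: right_edges.simps(2) intro: less_imp_le)
  show ?case
  proof (cases "a = p")
    case True
    have "r = Leaf"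
      using val le_val less True by (fastforce simp: not_less[symmetric])
    then show ?thesis
      using True by auto
  next
    case False
    show ?thesis
    proof (cases "r = Leaf")
      case True
      then show ?thesis
        using Node.IH(1) sorted False Node.prems by auto
    next
      case nonleaf: False
      then have "p \<notin> set_tree l"
        using cross val le_val by (fastforce simp: not_less[symmetric])
      with nonleaf show ?thesis
        using Node.IH(2) sorted False Node.prems
        by (auto simp: right_edges_Node simp del: right_edges.simps(2))
    qed
  qed
qed simp

section \<open>The invariant of the construction\<close>

text \<open>Each step of the fold puts node \<open>i\<close> at the end of the preorder, by
  \<open>attach_left_last\<close> or \<open>attach_right_last\<close>; in the second case it adds
  the reversal of the edge of \<open>B\<close> leaving \<open>i\<close>.\<close>

lemma theta_fold:
  assumes "1 \<le> i" "i \<le> size B"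
  defines "T \<equiv> fold (theta_step B) (rev [i..<size B]) (Node Leaf (size B) Leaf)"
  shows "preorder T = rev [i..<size B + 1] \<and>
    right_edges T = {(w, u). (u, w) \<in> right_edges (numbered B) \<and> i \<le> u}"
proof -
  define E where "E = right_edges (numbered B)"
  have bounds: "1 \<le> u \<and> u < w \<and> w \<le> size B" if "(u, w) \<in> E" for u w
    using that right_edges_number_from_bounds[of u w 1 B] by (simp add: E_def numbered_def)
  define S where "S i = fold (theta_step B) (rev [i..<size B]) (Node Leaf (size B) Leaf)" for i
  have "preorder (S i) = rev [i..<size B + 1] \<and>
      right_edges (S i) = {(w, u). (u, w) \<in> E \<and> i \<le> u}"
    using assms(2,1)
  proof (induction i rule: inc_induct)
    \<comment> \<open>The induction runs down from \<open>size B\<close>, in the order of the fold.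
      No right edge of \<open>B\<close> starts at its last node, in accordance with the single
      root.\<close>
    case base
    then show ?case
      using bounds by (fastforce simp: S_def)
  next
    case (step i)
    from step.IH step.prems have pre: "preorder (S (Suc i)) = rev [Suc i..<size B + 1]"
      and edges: "right_edges (S (Suc i)) = {(w, u). (u, w) \<in> E \<and> Suc i \<le> u}"
      by simp_all
    have S: "S i = theta_step B i (S (Suc i))"
      using step.hyps by (simp add: S_def upt_conv_Cons del: upt_Suc)
    have sorted: "sorted_wrt (>) (preorder (S (Suc i)))"
      unfolding pre sorted_wrt_rev by (simp del: upt_Suc)
    have set: "set_tree (S (Suc i)) = {Suc i..size B}"
      using arg_cong[OF pre, of set] by (simp del: upt_Suc add: atLeastLessThanSuc_atLeastAtMost)
    have upt: "rev [i..<size B + 1] = preorder (S (Suc i)) @ [i]"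
      using step.hyps by (simp add: pre upt_conv_Cons[of i] del: upt_Suc)
    show ?case
    proof (cases "\<exists>k. (i, k) \<in> E")
      case True
      then obtain k where k: "(i, k) \<in> E"
        by blast
      have unique: "k' = k" if "(i, k') \<in> E" for k'
        using right_edges_number_from_unique that k by (simp add: E_def numbered_def) blast
      then have "(THE k. (i, k) \<in> E) = k"
        using k by blast
      then have "S i = attach_right k i (S (Suc i))"
        using True S by (simp add: theta_step_def E_def)
      moreover have mem: "k \<in> set_tree (S (Suc i))"
        using bounds[OF k] set by simp
      \<comment> \<open>The pair \<open>(w, u)\<close> is an edge of \<open>B\<close> with
        \<open>i < w\<close>. If \<open>w < k\<close>, it would start strictly between
        \<open>i\<close> and \<open>k\<close>, hence end before \<open>k\<close> by noncrossing,
        against \<open>k \<le> u\<close>.\<close>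
      have open_node: "k \<le> w" if "(u, w) \<in> right_edges (S (Suc i))" "k \<le> u" for u w
        using that right_edges_number_from_noncrossing[of i k 1 B w u] k
        by (fastforce simp: edges E_def numbered_def)
      moreover have "{(w, u). (u, w) \<in> E \<and> i \<le> u} =
          insert (k, i) {(w, u). (u, w) \<in> E \<and> Suc i \<le> u}"
        using k by (auto dest: unique simp: Suc_le_eq order.order_iff_strict[of i])
      moreover have "preorder (attach_right k i (S (Suc i))) = preorder (S (Suc i)) @ [i] \<and>
          right_edges (attach_right k i (S (Suc i))) = insert (k, i) (right_edges (S (Suc i)))"
        using sorted mem open_node by (rule attach_right_last)
      ultimately show ?thesis
        using upt edges by (simp del: upt_Suc)
    next
      case False
      then have "S i = attach_left (Suc i) i (S (Suc i))"
        using S by (simp add: theta_step_def E_def)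
      moreover have "Suc i \<in> set_tree (S (Suc i))" "\<And>x. x \<in> set_tree (S (Suc i)) \<Longrightarrow> Suc i \<le> x"
        using step.hyps set by auto
      moreover have "{(w, u). (u, w) \<in> E \<and> i \<le> u} = {(w, u). (u, w) \<in> E \<and> Suc i \<le> u}"
        using False by (auto simp: Suc_le_eq order.order_iff_strict[of i])
      ultimately show ?thesis
        using attach_left_last[OF sorted, of "Suc i" i] upt edges by (simp del: upt_Suc)
    qed
  qed
  then show ?thesis
    by (simp add: S_def T_def E_def)
qed

subsection \<open>Trees with reflected right edges\<close>

text \<open>A relation between trees that is symmetric and determines \<open>C\<close>; every claim
  about \<open>theta\<close> is derived from it, without returning to the construction.\<close>

definition reflected :: "unit tree \<Rightarrow> unit tree \<Rightarrow> bool" where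
  "reflected B C \<longleftrightarrow> size C = size B \<and>
     (\<forall>u \<in> {1..size B}. \<forall>w \<in> {1..size B}. (u, w) \<in> right_edges (numbered C) \<longleftrightarrow>
        (size B + 1 - w, size B + 1 - u) \<in> right_edges (numbered B))"

lemma set_numbered: "set_tree (numbered B) = {1..size B}"
  unfolding numbered_def set_number_from by auto

lemma right_edges_numbered_bounds:
  assumes "(u, w) \<in> right_edges (numbered B)"
  shows "1 \<le> u" "u \<le> size B" "1 \<le> w" "w \<le> size B"
  using assms right_edges_subset[of "numbered B"] by (auto simp: set_numbered)

text \<open>By \<open>theta_fold\<close> at \<open>i = 1\<close>, the labelled tree visits the nodes
  in the order n, ..., 1 and has the reversed edges of \<open>B\<close>. Numbering it by its own
  preorder moves label \<open>x\<close> to position \<open>n + 1 - x\<close>.\<close>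

lemma reflected_theta:
  assumes "size B \<ge> 1"
  shows "reflected B (theta B)"
proof -
  define n where "n = size B"
  define T where "T = fold (theta_step B) (rev [1..<n]) (Node Leaf n Leaf)"
  have pre: "preorder T = rev [1..<n + 1]"
    and edges: "right_edges T = {(w, u). (u, w) \<in> right_edges (numbered B)}"
    using theta_fold[of 1 B] assms right_edges_numbered_bounds(1)[of _ _ B]
    by (auto simp: T_def n_def)
  have size: "size T = n"
    using arg_cong[OF pre, of length] by simp
  have "map (\<lambda>x. n + 1 - x) (preorder T) = [1..<1 + size T]"
    unfolding pre size by (rule nth_equalityI) (simp_all add: rev_nth del: upt_Suc)
  then have num: "numbered (theta B) = map_tree (\<lambda>x. n + 1 - x) T"
    unfolding theta_def numbered_def T_def n_def by (rule number_from_unlabel)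
  have "(u, w) \<in> right_edges (numbered (theta B)) \<longleftrightarrow>
      (n + 1 - w, n + 1 - u) \<in> right_edges (numbered B)"
    if "u \<in> {1..n}" "w \<in> {1..n}" for u w
  proof
    assume "(u, w) \<in> right_edges (numbered (theta B))"
    then obtain x y where "(x, y) \<in> right_edges (numbered B)" "u = n + 1 - y" "w = n + 1 - x"
      by (auto simp: num right_edges_map_tree edges)
    then show "(n + 1 - w, n + 1 - u) \<in> right_edges (numbered B)"
      using right_edges_numbered_bounds[of x y B] by (simp add: n_def)
  next
    assume "(n + 1 - w, n + 1 - u) \<in> right_edges (numbered B)"
    then have "map_prod (\<lambda>x. n + 1 - x) (\<lambda>x. n + 1 - x) (n + 1 - u, n + 1 - w)
        \<in> right_edges (numbered (theta B))"
      unfolding num right_edges_map_tree edges by blast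
    then show "(u, w) \<in> right_edges (numbered (theta B))"
      using that by simp
  qed
  moreover have "size (theta B) = n"
    using size by (simp add: theta_def unlabel_def T_def n_def)
  ultimately show ?thesis
    by (simp add: reflected_def n_def)
qed

lemma reflected_sym:
  assumes "reflected B C"
  shows "reflected C B"
  unfolding reflected_def
proof (intro conjI ballI)
  show size: "size B = size C"
    using assms by (simp add: reflected_def)
  fix u w assume uw: "u \<in> {1..size C}" "w \<in> {1..size C}"
  then have "size C + 1 - w \<in> {1..size B}" "size C + 1 - u \<in> {1..size B}"
    using size by auto
  then have "(size C + 1 - w, size C + 1 - u) \<in> right_edges (numbered C) \<longleftrightarrow>
      (size B + 1 - (size C + 1 - u), size B + 1 - (size C + 1 - w)) \<in> right_edges (numbered B)"
    using assms unfolding reflected_def by blast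
  then show "(u, w) \<in> right_edges (numbered B) \<longleftrightarrow>
      (size C + 1 - w, size C + 1 - u) \<in> right_edges (numbered C)"
    using size uw by simp
qed

text \<open>Both trees have the same size and the same right edges, and these determine a binary
  tree.\<close>

lemma reflected_unique:
  assumes "reflected B C" "reflected B D"
  shows "C = D"
proof (rule right_edges_number_from_inject[of _ _ 1])
  have sizes: "size C = size B" "size D = size B"
    using assms by (simp_all add: reflected_def)
  then show "size C = size D"
    by simp
  have "(u, w) \<in> right_edges (numbered C) \<longleftrightarrow> (u, w) \<in> right_edges (numbered D)" for u w
  proof (cases "u \<in> {1..size B} \<and> w \<in> {1..size B}")
    case True
    then show ?thesis
      using assms by (simp add: reflected_def)
  next
    case False
    then show ?thesis
      using right_edges_numbered_bounds[of u w C] right_edges_numbered_bounds[of u w D] sizes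
      by auto
  qed
  then show "right_edges (number_from 1 C) = right_edges (number_from 1 D)"
    unfolding numbered_def by (intro set_eqI) (simp only: split_paired_all)
qed

section \<open>Transport of right chains\<close>

text \<open>The reflection sends the source of an edge to the target of its image, whence the
  \<open>rev\<close>.\<close>

lemma right_path_reflected:
  assumes "reflected B C" "right_path (numbered B) p"
  shows "right_path (numbered C) (rev (map (\<lambda>x. size B + 1 - x) p))"
proof -
  have p: "p \<noteq> []" "set p \<subseteq> {1..size B}"
    "successively (\<lambda>u w. (u, w) \<in> right_edges (numbered B)) p"
    using assms(2) by (auto simp: right_path_def set_numbered)
  have size: "size B = size C"
    using assms by (simp add: reflected_def)
  have "(size B + 1 - w, size B + 1 - u) \<in> right_edges (numbered C)"
    if "(u, w) \<in> right_edges (numbered B)" for u w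
    using that right_edges_numbered_bounds[OF that] reflected_sym[OF assms(1)] size
    by (simp add: reflected_def)
  then have path: "successively (\<lambda>u w. (u, w) \<in> right_edges (numbered C))
      (rev (map (\<lambda>x. size B + 1 - x) p))"
    unfolding successively_rev successively_map
    by (intro successively_mono[OF p(3)]) auto
  have "set (rev (map (\<lambda>x. size B + 1 - x) p)) \<subseteq> {1..size C}"
    using p(2) size by fastforce
  with path show ?thesis
    using p(1) by (simp add: right_path_def set_numbered)
qed

text \<open>Maximality carries over because the reflection of paths is an involution that respects
  \<open>sublist\<close>: a path extending the image of \<open>p\<close> reflects back to one
  extending \<open>p\<close>.\<close>

lemma right_chain_reflected:
  assumes "reflected B C" "right_chain (numbered B) p"
  shows "right_chain (numbered C) (rev (map (\<lambda>x. size B + 1 - x) p))"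
proof -
  define g where "g = (\<lambda>p. rev (map (\<lambda>x. size B + 1 - x) p))"
  have size: "size B = size C"
    using assms by (simp add: reflected_def)
  have gg: "g (g p) = p" if "set p \<subseteq> {1..size B}" for p
    using that by (auto simp: g_def rev_map intro!: map_idI)
  have p: "right_path (numbered B) p" "set p \<subseteq> {1..size B}"
    using assms(2) by (auto simp: right_chain_def right_path_def set_numbered)
  have "q = g p" if q: "right_path (numbered C) q" "sublist (g p) q" for q
  proof -
    have "sublist (g (g p)) (g q)"
      using map_mono_sublist[OF q(2), of "\<lambda>x. size B + 1 - x"]
      by (simp only: g_def sublist_rev)
    moreover have "right_path (numbered B) (g q)"
      using right_path_reflected[OF reflected_sym[OF assms(1)] q(1)] size by (simp add: g_def)
    ultimately have "g q = p"
      using assms(2) gg[OF p(2)] by (simp add: right_chain_def)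
    then show ?thesis
      using gg[of q] q(1) size by (auto simp: right_path_def set_numbered)
  qed
  then show ?thesis
    using right_path_reflected[OF assms(1) p(1)] by (simp add: right_chain_def g_def)
qed

lemma right_chain_sequence_reflected:
  assumes "reflected B C"
  shows "right_chain_sequence C = right_chain_sequence B"
proof -
  define g where "g = (\<lambda>p. rev (map (\<lambda>x. size B + 1 - x) p))"
  have size: "size B = size C"
    using assms by (simp add: reflected_def)
  have gg: "g (g p) = p" if "set p \<subseteq> {1..size B}" for p
    using that by (auto simp: g_def rev_map intro!: map_idI)
  have set: "set p \<subseteq> {1..size D}" if "right_chain (numbered D) p" for D :: "unit tree" and p
    using that by (auto simp: right_chain_def right_path_def set_numbered)
  have inj: "inj_on g {p. right_chain (numbered B) p}"
    by (rule inj_on_inverseI[of _ g]) (use gg set in auto)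
  have "{p. right_chain (numbered C) p} = g ` {p. right_chain (numbered B) p}"
  proof (intro equalityI subsetI)
    fix q assume "q \<in> {p. right_chain (numbered C) p}"
    then have "right_chain (numbered B) (g q)" "g (g q) = q"
      using right_chain_reflected[OF reflected_sym[OF assms], of q] gg[of q] set[of C q] size
      by (auto simp: g_def)
    then show "q \<in> g ` {p. right_chain (numbered B) p}"
      by (metis imageI mem_Collect_eq)
  next
    fix q assume "q \<in> g ` {p. right_chain (numbered B) p}"
    then show "q \<in> {p. right_chain (numbered C) p}"
      using right_chain_reflected[OF assms] by (auto simp: g_def)
  qed
  then have "mset_set {p. right_chain (numbered C) p} =
      image_mset g (mset_set {p. right_chain (numbered B) p})"
    using image_mset_mset_set[OF inj] by simp
  then show ?thesis
    by (simp add: right_chain_sequence_def multiset.map_comp comp_def g_def)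
qed

section \<open>Exchange of \<open>spi\<close> and \<open>rspi\<close>\<close>

lemma spi_reflected:
  assumes "reflected B C"
  shows "spi C = rspi B"
proof -
  have size: "size C = size B"
    using assms by (simp add: reflected_def)
  have iff: "(u, w) \<in> right_edges (numbered C) \<longleftrightarrow>
      (size B + 1 - w, size B + 1 - u) \<in> right_edges (numbered B)"
    if "u \<in> {1..size B}" "w \<in> {1..size B}" for u w
    using assms that by (simp add: reflected_def)
  have target: "(\<exists>u. (u, preorder (numbered C) ! i) \<in> right_edges (numbered C)) \<longleftrightarrow>
      (\<exists>w. (rev_preorder (numbered B) ! i, w) \<in> right_edges (numbered B))"
    if "i < size B" for i
  proof -
    \<comment> \<open>Positions count from 0 and labels from 1; the two labels are mirror images,
      since \<open>size B + 1 - (i + 1) = size B - i\<close>.\<close>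
    have nth: "preorder (numbered C) ! i = i + 1" "rev_preorder (numbered B) ! i = size B - i"
      using that
      by (simp_all add: preorder_numbered rev_preorder_eq rev_nth size del: upt_Suc)
    show ?thesis
      unfolding nth
    proof
      assume "\<exists>u. (u, i + 1) \<in> right_edges (numbered C)"
      then obtain u where u: "(u, i + 1) \<in> right_edges (numbered C)"
        by blast
      then show "\<exists>w. (size B - i, w) \<in> right_edges (numbered B)"
        using iff[of u "i + 1"] right_edges_numbered_bounds[OF u] size by auto
    next
      assume "\<exists>w. (size B - i, w) \<in> right_edges (numbered B)"
      then obtain w where w: "(size B - i, w) \<in> right_edges (numbered B)"
        by blast
      then have "(size B + 1 - w, i + 1) \<in> right_edges (numbered C)"
        using right_edges_numbered_bounds[OF w] that by (subst iff) auto
      then show "\<exists>u. (u, i + 1) \<in> right_edges (numbered C)"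
        by blast
    qed
  qed
  \<comment> \<open>Needed in both directions, to match the convention for trees without right
    edges.\<close>
  have empty: "right_edges (numbered D) = {}"
    if "reflected D D'" "right_edges (numbered D') = {}" for D D'
  proof (rule ccontr)
    assume "right_edges (numbered D) \<noteq> {}"
    then obtain u w where uw: "(u, w) \<in> right_edges (numbered D)"
      by auto
    then have "(size D' + 1 - w, size D' + 1 - u) \<in> right_edges (numbered D')"
      using reflected_sym[OF that(1)] right_edges_numbered_bounds[OF uw]
      by (simp add: reflected_def)
    with that(2) show False
      by simp
  qed
  have "right_edges (numbered C) = {} \<longleftrightarrow> right_edges (numbered B) = {}"
    using empty[OF assms] empty[OF reflected_sym[OF assms]] by blast
  moreover have "(\<lambda>i. i < size C \<and> (\<exists>u. (u, preorder (numbered C) ! i) \<in> right_edges (numbered C))) =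
      (\<lambda>i. i < size B \<and> (\<exists>w. (rev_preorder (numbered B) ! i, w) \<in> right_edges (numbered B)))"
    by (intro ext) (use target size in auto)
  ultimately show ?thesis
    using size by (simp add: spi_def rspi_def Let_def)
qed

theorem theorem3p1:
  fixes n :: nat
  assumes "n \<ge> 1"
  shows "theta \<in> binary_trees n \<rightarrow> binary_trees n \<and>
    (\<forall>B \<in> binary_trees n.
       theta (theta B) = B \<and>
       right_chain_sequence (theta B) = right_chain_sequence B \<and>
       spi (theta B) = rspi B \<and>
       rspi (theta B) = spi B)"
proof (intro conjI ballI Pi_I)
  fix B assume "B \<in> binary_trees n"
  then have size: "size B = n"
    by (simp add: binary_trees_def)
  then have refl: "reflected B (theta B)"
    using reflected_theta assms by simp
  then have size': "size (theta B) = n"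
    using size by (simp add: reflected_def)
  then show "theta B \<in> binary_trees n"
    by (simp add: binary_trees_def)
  have "reflected (theta B) (theta (theta B))"
    using reflected_theta assms size' by simp
  \<comment> \<open>By symmetry \<open>B\<close> is a reflection of \<open>theta B\<close>, just as
    \<open>theta (theta B)\<close> is.\<close>
  then show "theta (theta B) = B"
    using reflected_unique reflected_sym[OF refl] by blast
  show "right_chain_sequence (theta B) = right_chain_sequence B"
    using right_chain_sequence_reflected[OF refl] .
  show "spi (theta B) = rspi B"
    using spi_reflected[OF refl] .
  show "rspi (theta B) = spi B"
    using spi_reflected[OF reflected_sym[OF refl]] by simp
qed

end
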